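(* Let $r=2$ and $K>0$. There are constants $C,C'\in(0,\infty)$ depending only on $K$ such that for every $1\le p<\infty$, every strictly increasing sequence $\Lambda=\{\lambda_n\}_{n\in\mathbb Z}\subset\mathbb R$ with $\lambda_{n+1}-\lambda_n\le K$ for all $n\in\mathbb Z$, and every $f:\Lambda\to\mathbb C$, $$C\,\|f\|_{\mathrm{eq},W}\le\|f\|_{\mathrm{simp},W}\le C'\,\|f\|_{\mathrm{eq},W}.$$
   Context: Divided differences: $f(x_1)$ is the value at $x_1$, $f(x_1,x_2)=\frac{f(x_2)-f(x_1)}{x_2-x_1}$, and $f(x_1,x_2,x_3)=\frac{f(x_2,x_3)-f(x_1,x_2)}{x_3-x_1}$. For $r=2$ and $f:\Lambda\to\mathbb C$ define (with values in $[0,\infty]$) $$\|f\|_{\mathrm{eq},L}^p=\sum_{n\in\mathbb Z}(\lambda_{n+2}-\lambda_n)|f(\lambda_n,\lambda_{n+1},\lambda_{n+2})|^p,$$ $$\|f\|_{\mathrm{eq},W}^p=\|f\|_{\mathrm{eq},L}^p+\sum_{n\in\mathbb Z}(\lambda_{n+2}-\lambda_n)|f(\lambda_n)|^p+\sum_{n\in\mathbb Z}(\lambda_{n+2}-\lambda_n)^{p+1}|f(\lambda_n,\lambda_{n+1})|^p,$$ $$\|f\|_{\mathrm{simp},W}^p=\|f\|_{\mathrm{eq},L}^p+\sum_{n\in\mathbb Z}(\lambda_{n+1}-\lambda_{n-1})|f(\lambda_n)|^p.$$ *)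

theory Defs
  imports "HOL-Analysis.Analysis"
begin

definition divdiff2 :: "(real \<Rightarrow> complex) \<Rightarrow> real \<Rightarrow> real \<Rightarrow> complex" where
  "divdiff2 f x1 x2 = (f x2 - f x1) / of_real (x2 - x1)"

definition divdiff3 :: "(real \<Rightarrow> complex) \<Rightarrow> real \<Rightarrow> real \<Rightarrow> real \<Rightarrow> complex" where
  "divdiff3 f x1 x2 x3 = (divdiff2 f x2 x3 - divdiff2 f x1 x2) / of_real (x3 - x1)"

text \<open>The power \<open>x\<^sup>a\<close> on \<open>[0,\<infinity>]\<close>, meant for exponents \<open>a > 0\<close> only.\<close>

definition ennreal_powr :: "ennreal \<Rightarrow> real \<Rightarrow> ennreal" where
  "ennreal_powr x a = (if x = top then top else ennreal (enn2real x powr a))"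

text \<open>
  The sums \<open>eqL_sum\<close>, \<open>eqW_sum\<close>, \<open>simpW_sum\<close> are the \<open>p\<close>-th powers of the norms. They take
  values in \<open>[0,\<infinity>]\<close>, where every family is summable. The set \<open>\<Lambda>\<close> is given by its strictly
  increasing enumeration \<open>l\<close>, and a function on \<open>\<Lambda>\<close> is represented by a function on the reals,
  of which only the values on \<open>\<Lambda>\<close> are used.
\<close>

definition eqL_sum :: "real \<Rightarrow> (int \<Rightarrow> real) \<Rightarrow> (real \<Rightarrow> complex) \<Rightarrow> ennreal" where
  "eqL_sum p l f =
    (\<Sum>\<^sub>\<infinity>n\<in>UNIV. ennreal ((l (n + 2) - l n) *
       norm (divdiff3 f (l n) (l (n + 1)) (l (n + 2))) powr p))"

definition eqW_sum :: "real \<Rightarrow> (int \<Rightarrow> real) \<Rightarrow> (real \<Rightarrow> complex) \<Rightarrow> ennreal" where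
  "eqW_sum p l f =
    eqL_sum p l f
    + (\<Sum>\<^sub>\<infinity>n\<in>UNIV. ennreal ((l (n + 2) - l n) * norm (f (l n)) powr p))
    + (\<Sum>\<^sub>\<infinity>n\<in>UNIV. ennreal ((l (n + 2) - l n) powr (p + 1) *
         norm (divdiff2 f (l n) (l (n + 1))) powr p))"

definition simpW_sum :: "real \<Rightarrow> (int \<Rightarrow> real) \<Rightarrow> (real \<Rightarrow> complex) \<Rightarrow> ennreal" where
  "simpW_sum p l f =
    eqL_sum p l f
    + (\<Sum>\<^sub>\<infinity>n\<in>UNIV. ennreal ((l (n + 1) - l (n - 1)) * norm (f (l n)) powr p))"

definition norm_eqW :: "real \<Rightarrow> (int \<Rightarrow> real) \<Rightarrow> (real \<Rightarrow> complex) \<Rightarrow> ennreal" where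
  "norm_eqW p l f = ennreal_powr (eqW_sum p l f) (1 / p)"

definition norm_simpW :: "real \<Rightarrow> (int \<Rightarrow> real) \<Rightarrow> (real \<Rightarrow> complex) \<Rightarrow> ennreal" where
  "norm_simpW p l f = ennreal_powr (simpW_sum p l f) (1 / p)"

end

theory Submission
  imports Defs
begin

text \<open>
  Write \<open>h\<^sub>n = l (n + 1) - l n\<close>, and let \<open>d\<^sub>n\<close>, \<open>t\<^sub>n\<close> be the divided differences of orders one and
  two starting at \<open>l n\<close>. The two norms are compared summand by summand, up to shifts of the index.
  To bound the simple norm by the full one, only \<open>h\<^sub>n\<^sub>-\<^sub>1 |f (l n)|\<^sup>p\<close> needs an argument, namely
  \<open>f (l n) = f (l (n - 1)) + h\<^sub>n\<^sub>-\<^sub>1 d\<^sub>n\<^sub>-\<^sub>1\<close>. In the other direction \<open>h\<^sub>n\<^sub>+\<^sub>1 |f (l n)|\<^sup>p\<close> is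
  treated through \<open>f (l n) = f (l (n + 1)) - h\<^sub>n d\<^sub>n\<close>, and the point is to bound
  \<open>(h\<^sub>n + h\<^sub>n\<^sub>+\<^sub>1)\<^bsup>p+1\<^esup> |d\<^sub>n|\<^sup>p\<close>. If \<open>h\<^sub>n\<^sub>+\<^sub>1 \<le> h\<^sub>n\<close>, use \<open>h\<^sub>n d\<^sub>n = f (l (n + 1)) - f (l n)\<close>. Otherwise
  \<open>h\<^sub>n\<^sub>+\<^sub>1 d\<^sub>n = f (l (n + 2)) - f (l (n + 1)) - h\<^sub>n\<^sub>+\<^sub>1 (h\<^sub>n + h\<^sub>n\<^sub>+\<^sub>1) t\<^sub>n\<close>, where the last product of
  steps is at most \<open>2 K\<^sup>2\<close>.
\<close>

section \<open>Unconditional sums in [0,\<infinity>]\<close>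

lemma infsum_mono_ennreal:
  fixes f g :: "'a \<Rightarrow> ennreal"
  assumes "\<And>x. x \<in> A \<Longrightarrow> f x \<le> g x"
  shows "infsum f A \<le> infsum g A"
  by (intro infsum_mono nonneg_summable_on_complete assms) auto

lemma infsum_add_ennreal:
  fixes f g :: "'a \<Rightarrow> ennreal"
  shows "(\<Sum>\<^sub>\<infinity>x\<in>A. f x + g x) = infsum f A + infsum g A"
  by (intro infsum_add nonneg_summable_on_complete) auto

text \<open>The infinite sum is a supremum of finite sums, and multiplication by any
  \<open>c\<close>, even \<open>top\<close>, commutes with suprema in [0,\<infinity>].\<close>

lemma infsum_cmult_right_ennreal:
  fixes f :: "'a \<Rightarrow> ennreal"
  shows "(\<Sum>\<^sub>\<infinity>x\<in>A. c * f x) = c * infsum f A"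
proof -
  have "(\<Sum>\<^sub>\<infinity>x\<in>A. c * f x) = (SUP F\<in>{F. finite F \<and> F \<subseteq> A}. c * sum f F)"
    by (subst nonneg_infsum_complete) (auto simp: sum_distrib_left)
  also have "\<dots> = c * infsum f A"
    by (subst nonneg_infsum_complete) (auto simp: SUP_mult_left_ennreal)
  finally show ?thesis .
qed

lemma infsum_shift_int:
  fixes f :: "int \<Rightarrow> 'b::{comm_monoid_add,t2_space}"
  shows "(\<Sum>\<^sub>\<infinity>n\<in>UNIV. f (n + k)) = infsum f UNIV"
proof -
  have "bij_betw (\<lambda>n::int. n + k) UNIV UNIV"
    by (rule bij_betw_byWitness[where f' = "\<lambda>n. n - k"]) auto
  then show ?thesis
    by (rule infsum_reindex_bij_betw)
qed

section \<open>Powers and roots with constants uniform in the exponent\<close>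

text \<open>Passes from sums to norms. A factor of the form \<open>c powr p\<close> has the
  \<open>p\<close>-th root \<open>c\<close>, which is why all constants below are brought into this
  form: the final ones must not depend on \<open>p\<close>.\<close>

lemma ennreal_powr_root_le:
  assumes "X \<le> ennreal (c powr p) * Y" "c > 0" "p > 0"
  shows "ennreal_powr X (1 / p) \<le> ennreal c * ennreal_powr Y (1 / p)"
proof (cases "Y = top")
  case True
  with assms show ?thesis
    by (simp add: ennreal_powr_def ennreal_mult_top)
next
  case False
  then obtain y where y: "Y = ennreal y" "y \<ge> 0"
    by (metis ennreal_cases infinity_ennreal_def)
  with assms have X: "X \<le> ennreal (c powr p * y)"
    by (simp add: ennreal_mult)
  then have "X \<noteq> top"
    by (auto simp: top_unique)
  then obtain x where x: "X = ennreal x" "x \<ge> 0"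
    by (metis ennreal_cases infinity_ennreal_def)
  have "x powr (1 / p) \<le> (c powr p * y) powr (1 / p)"
    using X x y assms by (intro powr_mono2) auto
  also have "\<dots> = c * y powr (1 / p)"
    using y assms by (simp add: powr_mult powr_powr)
  finally show ?thesis
    using x y assms by (simp add: ennreal_powr_def flip: ennreal_mult)
qed

text \<open>Going through twice the maximum instead of convexity costs a slightly larger factor but
  works for every \<open>p\<close> \<ge> 0. The version with three terms is analogous.\<close>

lemma powr_le_add_powr2:
  fixes a b c p :: real
  assumes "0 \<le> a" "0 \<le> b" "0 \<le> c" "a \<le> b + c" "0 \<le> p"
  shows "a powr p \<le> 2 powr p * (b powr p + c powr p)"
proof -
  have "a powr p \<le> (2 * max b c) powr p"
    using assms by (intro powr_mono2) auto
  also have "\<dots> = 2 powr p * max b c powr p"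
    using assms by (simp add: powr_mult)
  also have "\<dots> \<le> 2 powr p * (b powr p + c powr p)"
    by (intro mult_left_mono) (auto simp: max_def)
  finally show ?thesis .
qed

lemma powr_le_add_powr3:
  fixes a b c d p :: real
  assumes "0 \<le> a" "0 \<le> b" "0 \<le> c" "0 \<le> d" "a \<le> b + c + d" "0 \<le> p"
  shows "a powr p \<le> 3 powr p * (b powr p + c powr p + d powr p)"
proof -
  define m where "m = max b (max c d)"
  have m: "0 \<le> m" "m powr p \<le> b powr p + c powr p + d powr p" "b \<le> m" "c \<le> m" "d \<le> m"
    using assms by (auto simp: m_def max_def)
  have "a powr p \<le> (3 * m) powr p"
    using assms m by (intro powr_mono2) auto
  also have "\<dots> = 3 powr p * m powr p"
    using m by (simp add: powr_mult)
  also have "\<dots> \<le> 3 powr p * (b powr p + c powr p + d powr p)"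
    by (intro mult_left_mono m) auto
  finally show ?thesis .
qed

text \<open>Absorbs a numerical factor into the base, since \<open>a\<close> \<le>
  \<open>a powr p\<close>.\<close>

lemma const_mult_powr_le:
  fixes a c p :: real
  assumes "1 \<le> a" "0 \<le> c" "1 \<le> p"
  shows "a * c powr p \<le> (a * c) powr p"
  using powr_mono[of 1 p a] assms by (simp add: powr_mult mult_right_mono)

section \<open>Divided differences without denominators\<close>

lemma divdiff2_mult:
  assumes "x \<noteq> y"
  shows "of_real (y - x) * divdiff2 f x y = f y - f x"
  using assms by (simp add: divdiff2_def)

lemma divdiff3_mult:
  assumes "x \<noteq> z"
  shows "of_real (z - x) * divdiff3 f x y z = divdiff2 f y z - divdiff2 f x y"
  using assms by (simp add: divdiff3_def)

lemma norm_divdiff2_mult: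
  assumes "x < y"
  shows "(y - x) * norm (divdiff2 f x y) = norm (f y - f x)"
  using arg_cong[OF divdiff2_mult, of x y norm f] assms
  by (simp add: norm_mult flip: of_real_diff)

text \<open>The step \<open>z - y\<close> does not match the difference over \<open>x\<close>,
  \<open>y\<close>. The second-order difference replaces it by the one over \<open>y\<close>,
  \<open>z\<close>, at the price of the factor \<open>(z - y) * (z - x)\<close>, which the step
  bound \<open>K\<close> controls.\<close>

lemma norm_divdiff2_left_le:
  assumes "x < y" "y < z" "y - x \<le> K" "z - y \<le> K"
  shows "(z - y) * norm (divdiff2 f x y) \<le> norm (f y) + norm (f z) + 2 * K\<^sup>2 * norm (divdiff3 f x y z)"
proof -
  have "of_real (z - y) * divdiff2 f x y
      = f z - f y - of_real ((z - y) * (z - x)) * divdiff3 f x y z"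
  proof -
    have "of_real (z - y) * divdiff2 f x y = of_real (z - y) * divdiff2 f y z
        - of_real (z - y) * (divdiff2 f y z - divdiff2 f x y)"
      by (simp add: algebra_simps)
    also have "\<dots> = f z - f y - of_real (z - y) * (of_real (z - x) * divdiff3 f x y z)"
      using assms by (simp only: divdiff2_mult divdiff3_mult)
    finally show ?thesis
      by (simp add: mult.assoc)
  qed
  then have "norm (of_real (z - y) * divdiff2 f x y)
      \<le> norm (f z - f y) + norm (of_real ((z - y) * (z - x)) * divdiff3 f x y z)"
    by (metis norm_triangle_ineq4)
  moreover have "norm (of_real (z - y) * divdiff2 f x y) = (z - y) * norm (divdiff2 f x y)"
    using assms by (simp only: norm_mult norm_of_real)
  moreover have "norm (of_real ((z - y) * (z - x)) * divdiff3 f x y z)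
      = ((z - y) * (z - x)) * norm (divdiff3 f x y z)"
    using assms by (simp only: norm_mult norm_of_real) (simp add: abs_mult)
  moreover have "(z - y) * (z - x) \<le> K * (2 * K)"
    using assms by (intro mult_mono) auto
  then have "((z - y) * (z - x)) * norm (divdiff3 f x y z) \<le> 2 * K\<^sup>2 * norm (divdiff3 f x y z)"
    by (intro mult_right_mono) (auto simp: power2_eq_square)
  ultimately show ?thesis
    using norm_triangle_ineq4[of "f z" "f y"] by linarith
qed

section \<open>Weighted estimates at consecutive points\<close>

text \<open>Moves the weight of a step from its right end to its left end, where \<open>h\<close> is
  the weight in the full norm.\<close>

lemma weighted_value_right_le:
  assumes "w < x" "x < y" "0 \<le> p" "h = y - w"
  shows "(x - w) * norm (f x) powr p
    \<le> 2 powr p * (h * norm (f w) powr p + h powr (p + 1) * norm (divdiff2 f w x) powr p)"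
proof -
  have "norm (f x) \<le> norm (f w) + (x - w) * norm (divdiff2 f w x)"
    using norm_divdiff2_mult[of w x f] norm_triangle_ineq2[of "f x" "f w"] assms by simp
  also have "\<dots> \<le> norm (f w) + h * norm (divdiff2 f w x)"
    using assms by (intro add_left_mono mult_right_mono) auto
  finally have "norm (f x) powr p
      \<le> 2 powr p * (norm (f w) powr p + (h * norm (divdiff2 f w x)) powr p)"
    using assms by (intro powr_le_add_powr2) auto
  then have "(x - w) * norm (f x) powr p
      \<le> h * (2 powr p * (norm (f w) powr p + (h * norm (divdiff2 f w x)) powr p))"
    using assms by (intro mult_mono) auto
  moreover have "0 < h"
    using assms by simp
  ultimately show ?thesis
    by (simp add: powr_mult powr_add mult_ac distrib_left)
qed

text \<open>Here the value moves to the right: \<open>h\<close> is both the full norm's weight at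
  \<open>x\<close> and the simple norm's weight at \<open>y\<close>.\<close>

lemma weighted_value_left_le:
  assumes "x < y" "y < z" "0 \<le> p" "h = z - x"
  shows "(z - y) * norm (f x) powr p
    \<le> 2 powr p * (h * norm (f y) powr p + h powr (p + 1) * norm (divdiff2 f x y) powr p)"
proof -
  have "norm (f x) \<le> norm (f y) + (y - x) * norm (divdiff2 f x y)"
    using norm_divdiff2_mult[of x y f] norm_triangle_ineq3[of "f x" "f y"] assms
    by (simp add: norm_minus_commute)
  also have "\<dots> \<le> norm (f y) + h * norm (divdiff2 f x y)"
    using assms by (intro add_left_mono mult_right_mono) auto
  finally have "norm (f x) powr p
      \<le> 2 powr p * (norm (f y) powr p + (h * norm (divdiff2 f x y)) powr p)"
    using assms by (intro powr_le_add_powr2) auto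
  then have "(z - y) * norm (f x) powr p
      \<le> h * (2 powr p * (norm (f y) powr p + (h * norm (divdiff2 f x y)) powr p))"
    using assms by (intro mult_mono) auto
  moreover have "0 < h"
    using assms by simp
  ultimately show ?thesis
    by (simp add: powr_mult powr_add mult_ac distrib_left)
qed

text \<open>The outer points \<open>w\<close> and \<open>u\<close> supply the simple norm's weights
  \<open>y - w\<close> at \<open>x\<close> and \<open>u - y\<close> at \<open>z\<close>. The longer
  of the two inner steps is at least half of \<open>z - x\<close>, hence the two cases.\<close>

lemma weighted_divdiff2_le:
  fixes w x y z u K p M :: real
  assumes "w < x" "x < y" "y < z" "z < u" "1 \<le> p"
    and "y - x \<le> K" "z - y \<le> K" "M = max 1 (2 * K\<^sup>2)"
  shows "(z - x) powr (p + 1) * norm (divdiff2 f x y) powr p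
    \<le> (12 * M) powr p * ((y - w) * norm (f x) powr p + (z - x) * norm (f y) powr p
        + (u - y) * norm (f z) powr p + (z - x) * norm (divdiff3 f x y z) powr p)"
    (is "?B \<le> _ * (?X + ?Y + ?Z + ?T)")
proof -
  \<comment> \<open>One of the \<open>p + 1\<close> powers of \<open>z - x\<close> stays outside as
    the weight.\<close>
  have B: "?B = (z - x) * ((z - x) * norm (divdiff2 f x y)) powr p"
    using assms by (simp add: powr_add powr_mult)
  have p: "0 \<le> p" and nonneg: "0 \<le> (z - x) * norm (divdiff2 f x y)"
    using assms by auto
  have M: "1 \<le> M" "2 * K\<^sup>2 \<le> M" "0 \<le> M"
    using assms by auto
  have XYZT: "0 \<le> ?X" "0 \<le> ?Y" "0 \<le> ?Z" "0 \<le> ?T"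
    using assms by auto
  show ?thesis
  proof (cases "z - y \<le> y - x")
    case True
    have "(z - x) * norm (divdiff2 f x y) \<le> (2 * (y - x)) * norm (divdiff2 f x y)"
      using True by (intro mult_right_mono) auto
    also have "\<dots> \<le> 2 * norm (f x) + 2 * norm (f y)"
      using norm_divdiff2_mult[of x y f] norm_triangle_ineq4[of "f y" "f x"] assms
      by (simp only: mult.assoc)
    finally have "((z - x) * norm (divdiff2 f x y)) powr p
        \<le> 2 powr p * ((2 * norm (f x)) powr p + (2 * norm (f y)) powr p)"
      using assms by (intro powr_le_add_powr2) auto
    also have "\<dots> = 4 powr p * (norm (f x) powr p + norm (f y) powr p)"
      using powr_mult[of 2 2 p] by (simp add: powr_mult algebra_simps)
    finally have "?B \<le> (2 * (y - x)) * (4 powr p * (norm (f x) powr p + norm (f y) powr p))"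
      unfolding B using True assms by (intro mult_mono) auto
    also have "\<dots> = 2 * 4 powr p * ((y - x) * norm (f x) powr p + (y - x) * norm (f y) powr p)"
      by (simp add: algebra_simps)
    also have "\<dots> \<le> 2 * 4 powr p * (?X + ?Y)"
      using assms by (intro mult_left_mono add_mono mult_right_mono) auto
    also have "\<dots> \<le> (12 * M) powr p * (?X + ?Y + ?Z + ?T)"
    proof (intro mult_mono)
      have "2 * 4 powr p \<le> (2 * 4) powr p"
        using assms by (intro const_mult_powr_le) auto
      also have "\<dots> \<le> (12 * M) powr p"
        using M assms by (intro powr_mono2) auto
      finally show "2 * 4 powr p \<le> (12 * M) powr p" .
    qed (use XYZT in auto)
    finally show ?thesis .
  next
    case False
    let ?t = "norm (divdiff3 f x y z)"
    have "(z - x) * norm (divdiff2 f x y) \<le> (2 * (z - y)) * norm (divdiff2 f x y)"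
      using False by (intro mult_right_mono) auto
    also have "\<dots> \<le> 2 * (norm (f y) + norm (f z) + M * ?t)"
    proof -
      have "(z - y) * norm (divdiff2 f x y) \<le> norm (f y) + norm (f z) + M * ?t"
        using norm_divdiff2_left_le[OF assms(2,3,6,7), of f]
          mult_right_mono[OF M(2) norm_ge_zero, of "divdiff3 f x y z"]
        by (rule order_trans[OF _ add_left_mono])
      then show ?thesis
        by (simp only: mult.assoc mult_left_mono)
    qed
    \<comment> \<open>As \<open>M\<close> \<ge> 1, it may be put on every term, so that one common
      power can be factored out.\<close>
    also have "\<dots> \<le> 2 * (M * norm (f y) + M * norm (f z) + M * ?t)"
      using mult_right_mono[OF M(1), of "norm (f y)"] mult_right_mono[OF M(1), of "norm (f z)"]
      by simp
    finally have "((z - x) * norm (divdiff2 f x y)) powr p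
        \<le> 3 powr p * ((2 * M * norm (f y)) powr p + (2 * M * norm (f z)) powr p
            + (2 * M * ?t) powr p)"
      using p M by (intro powr_le_add_powr3 nonneg) (auto simp: algebra_simps)
    also have "\<dots> = (3 * (2 * M)) powr p * (norm (f y) powr p + norm (f z) powr p + ?t powr p)"
      using M by (simp only: powr_mult) (simp add: algebra_simps)
    finally have "?B \<le> (2 * (z - y))
        * ((6 * M) powr p * (norm (f y) powr p + norm (f z) powr p + ?t powr p))"
      unfolding B using False assms by (intro mult_mono) auto
    also have "\<dots> = 2 * (6 * M) powr p
        * ((z - y) * norm (f y) powr p + (z - y) * norm (f z) powr p + (z - y) * ?t powr p)"
      by (simp add: algebra_simps)
    also have "\<dots> \<le> 2 * (6 * M) powr p * (?Y + ?Z + ?T)"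
      using assms by (intro mult_left_mono add_mono mult_right_mono) auto
    also have "\<dots> \<le> (12 * M) powr p * (?X + ?Y + ?Z + ?T)"
    proof (intro mult_mono)
      show "2 * (6 * M) powr p \<le> (12 * M) powr p"
        using const_mult_powr_le[of 2 "6 * M" p] M assms by auto
    qed (use XYZT in auto)
    finally show ?thesis .
  qed
qed

section \<open>Comparison of the two sums\<close>

text \<open>In the simple weight at a point, the step to the right is part of the full weight there,
  while the step to the left is charged to the preceding point.\<close>

lemma simpW_sum_le:
  assumes l: "strict_mono l" and p: "1 \<le> p"
  shows "simpW_sum p l f \<le> ennreal (3 powr p) * eqW_sum p l f"
proof -
  define a where "a n = (l (n + 2) - l n) * norm (f (l n)) powr p" for n
  define b where "b n = (l (n + 2) - l n) powr (p + 1) *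
      norm (divdiff2 f (l n) (l (n + 1))) powr p" for n
  define s where "s n = (l (n + 1) - l (n - 1)) * norm (f (l n)) powr p" for n
  define A B S where "A = (\<Sum>\<^sub>\<infinity>n\<in>UNIV. ennreal (a n))" "B = (\<Sum>\<^sub>\<infinity>n\<in>UNIV. ennreal (b n))"
    "S = (\<Sum>\<^sub>\<infinity>n\<in>UNIV. ennreal (s n))"
  have l': "l m < l n \<longleftrightarrow> m < n" for m n
    using l by (rule strict_mono_less)
  have nonneg: "0 \<le> a n" "0 \<le> b n" for n
    using l'[of n "n + 2"] by (auto simp: a_def b_def)
  \<comment> \<open>Stated at \<open>n + 1\<close> so that the preceding index is \<open>n\<close>;
    the sum over all integers does not see the shift.\<close>
  have s_le: "s (n + 1) \<le> a (n + 1) + 2 powr p * (a n + b n)" for n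
  proof -
    have "(l (n + 1) - l n) * norm (f (l (n + 1))) powr p \<le> 2 powr p * (a n + b n)"
      unfolding a_def b_def using p
      by (intro weighted_value_right_le[where y = "l (n + 2)"]) (auto simp: l')
    moreover have "(l (n + 2) - l (n + 1)) * norm (f (l (n + 1))) powr p \<le> a (n + 1)"
      unfolding a_def using l'[of "n + 2" "n + 1 + 2"]
      by (intro mult_right_mono) auto
    ultimately show ?thesis
      by (simp add: s_def algebra_simps)
  qed
  have "S = (\<Sum>\<^sub>\<infinity>n\<in>UNIV. ennreal (s (n + 1)))"
    unfolding A_B_S_def by (rule infsum_shift_int[symmetric])
  also have "\<dots> \<le> (\<Sum>\<^sub>\<infinity>n\<in>UNIV. ennreal (a (n + 1))
      + ennreal (2 powr p) * (ennreal (a n) + ennreal (b n)))"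
    using s_le nonneg by (intro infsum_mono_ennreal)
      (simp add: ennreal_leI flip: ennreal_plus ennreal_mult)
  also have "\<dots> = A + ennreal (2 powr p) * (A + B)"
    using infsum_shift_int[of "\<lambda>n. ennreal (a n)" 1]
    by (simp add: infsum_add_ennreal infsum_cmult_right_ennreal A_B_S_def)
  finally have S: "S \<le> A + ennreal (2 powr p) * (A + B)" .
  have "simpW_sum p l f = eqL_sum p l f + S"
    by (simp add: simpW_sum_def A_B_S_def s_def)
  also have "\<dots> \<le> eqW_sum p l f + ennreal (2 powr p) * eqW_sum p l f"
  proof -
    have E: "eqW_sum p l f = eqL_sum p l f + A + B"
      by (simp add: eqW_sum_def A_B_S_def a_def b_def)
    have "eqL_sum p l f + S \<le> (eqL_sum p l f + A) + ennreal (2 powr p) * (A + B)"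
      using S by (simp add: add.assoc add_left_mono)
    also have "\<dots> \<le> eqW_sum p l f + ennreal (2 powr p) * eqW_sum p l f"
    proof (intro add_mono mult_left_mono)
      show "eqL_sum p l f + A \<le> eqW_sum p l f"
        by (simp add: E)
      show "A + B \<le> eqW_sum p l f"
        by (simp add: E add.assoc add_increasing)
    qed auto
    finally show ?thesis .
  qed
  also have "\<dots> = ennreal (1 + 2 powr p) * eqW_sum p l f"
    by (simp add: ennreal_plus distrib_right)
  also have "1 + 2 powr p \<le> (3::real) powr p"
  proof -
    \<comment> \<open>Mirrors \<open>3 powr p\<close> = (2 + 1) \<open>3 powr (p - 1)\<close>; here
      \<open>p\<close> \<ge> 1 is essential.\<close>
    have "1 + (2::real) powr p = 2 powr (p - 1) * 2 + 1"
      by (simp add: powr_diff)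
    also have "\<dots> \<le> 3 powr (p - 1) * 2 + 3 powr (p - 1)"
      using p by (intro add_mono mult_right_mono powr_mono2 ge_one_powr_ge_zero) auto
    also have "\<dots> = 3 powr p"
      by (simp add: powr_diff)
    finally show ?thesis .
  qed
  then have "ennreal (1 + 2 powr p) * eqW_sum p l f \<le> ennreal (3 powr p) * eqW_sum p l f"
    by (intro mult_right_mono ennreal_leI) auto
  finally show ?thesis .
qed

text \<open>The first-order sum \<open>B\<close> is bounded first, because the bound for the values
  \<open>A\<close> contains \<open>B\<close>.\<close>

lemma eqW_sum_le:
  assumes l: "strict_mono l" and K: "\<And>n. l (n + 1) - l n \<le> K" and p: "1 \<le> p"
    and M: "M = max 1 (2 * K\<^sup>2)"
  shows "eqW_sum p l f \<le> ennreal ((500 * M) powr p) * simpW_sum p l f"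
proof -
  define a where "a n = (l (n + 2) - l n) * norm (f (l n)) powr p" for n
  define b where "b n = (l (n + 2) - l n) powr (p + 1) *
      norm (divdiff2 f (l n) (l (n + 1))) powr p" for n
  define s where "s n = (l (n + 1) - l (n - 1)) * norm (f (l n)) powr p" for n
  define t where "t n = (l (n + 2) - l n) *
      norm (divdiff3 f (l n) (l (n + 1)) (l (n + 2))) powr p" for n
  define A B S T where "A = (\<Sum>\<^sub>\<infinity>n\<in>UNIV. ennreal (a n))" "B = (\<Sum>\<^sub>\<infinity>n\<in>UNIV. ennreal (b n))"
    "S = (\<Sum>\<^sub>\<infinity>n\<in>UNIV. ennreal (s n))" "T = (\<Sum>\<^sub>\<infinity>n\<in>UNIV. ennreal (t n))"
  define c where "c = (12 * M) powr p"
  have l': "l m < l n \<longleftrightarrow> m < n" for m n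
    using l by (rule strict_mono_less)
  have nonneg: "0 \<le> a n" "0 \<le> b n" "0 \<le> s n" "0 \<le> t n" for n
    using l'[of n "n + 2"] l'[of "n - 1" "n + 1"] by (auto simp: a_def b_def s_def t_def)
  have M1: "1 \<le> M"
    using M by simp
  have powr_le: "x powr p \<le> (k * M) powr p" if "0 \<le> x" "x \<le> k" for x k :: real
    using that M1 p mult_mono[of x k 1 M] by (intro powr_mono2) auto
  have c: "1 \<le> c" "2 powr p \<le> c" "0 \<le> c"
    using powr_le[of 2 12] powr_le[of 1 12] by (auto simp: c_def)
  \<comment> \<open>With the five points from \<open>l (n - 1)\<close> to \<open>l (n + 3)\<close>,
    the three value terms are exactly \<open>s\<close> at \<open>n\<close>, \<open>n + 1\<close> and
    \<open>n + 2\<close>.\<close>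
  have b_le: "b n \<le> c * (s n + s (n + 1) + s (n + 2) + t n)" for n
    using weighted_divdiff2_le[of "l (n - 1)" "l n" "l (n + 1)" "l (n + 2)" "l (n + 3)" p K M f]
      K[of n] K[of "n + 1"] p M by (simp add: l' b_def s_def t_def c_def add.commute)
  have a_le: "a n \<le> s n + 2 powr p * (s (n + 1) + b n)" for n
  proof -
    have "(l (n + 2) - l (n + 1)) * norm (f (l n)) powr p \<le> 2 powr p * (s (n + 1) + b n)"
      using weighted_value_left_le[of "l n" "l (n + 1)" "l (n + 2)" p _ f] p
      by (simp add: b_def s_def l' add.commute)
    moreover have "(l (n + 1) - l n) * norm (f (l n)) powr p \<le> s n"
      unfolding s_def using l'[of "n - 1" n] by (intro mult_right_mono) auto
    ultimately show ?thesis
      by (simp add: a_def algebra_simps)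
  qed
  define Q where "Q = simpW_sum p l f"
  have Q: "Q = T + S"
    by (simp add: Q_def simpW_sum_def eqL_sum_def A_B_S_T_def s_def t_def)
  have E: "eqW_sum p l f = T + A + B"
    by (simp add: eqW_sum_def eqL_sum_def A_B_S_T_def a_def b_def t_def)
  have TS: "T \<le> Q" "S \<le> Q"
    by (auto simp: Q)
  have shift: "(\<Sum>\<^sub>\<infinity>n\<in>UNIV. ennreal (s (n + k))) = S" for k
    using infsum_shift_int[of "\<lambda>n. ennreal (s n)" k] by (simp add: A_B_S_T_def)
  have "B \<le> (\<Sum>\<^sub>\<infinity>n\<in>UNIV. ennreal c * (ennreal (s n) + ennreal (s (n + 1))
      + ennreal (s (n + 2)) + ennreal (t n)))"
    unfolding A_B_S_T_def using b_le nonneg c by (intro infsum_mono_ennreal)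
      (simp add: ennreal_leI flip: ennreal_plus ennreal_mult)
  also have "\<dots> = ennreal c * (S + S + S + T)"
    using shift[of 0] shift[of 1] shift[of 2]
    by (simp add: infsum_add_ennreal infsum_cmult_right_ennreal A_B_S_T_def)
  also have "\<dots> \<le> ennreal c * (Q + Q + Q + Q)"
    using TS by (intro mult_left_mono add_mono) auto
  also have "\<dots> = ennreal (4 * c) * Q"
  proof -
    have "(4::ennreal) = 1 + 1 + 1 + 1"
      by simp
    then have "4 * Q = Q + Q + Q + Q"
      by (simp only: distrib_right mult_1)
    then show ?thesis
      using c by (simp add: ennreal_mult mult.left_commute mult.assoc)
  qed
  finally have B: "B \<le> ennreal (4 * c) * Q" .
  have "A \<le> (\<Sum>\<^sub>\<infinity>n\<in>UNIV. ennreal (s n)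
      + ennreal (2 powr p) * (ennreal (s (n + 1)) + ennreal (b n)))"
    unfolding A_B_S_T_def using a_le nonneg by (intro infsum_mono_ennreal)
      (simp add: ennreal_leI flip: ennreal_plus ennreal_mult)
  also have "\<dots> = S + ennreal (2 powr p) * (S + B)"
    using shift[of 1] by (simp add: infsum_add_ennreal infsum_cmult_right_ennreal A_B_S_T_def)
  also have "\<dots> \<le> Q + ennreal (2 powr p) * (Q + ennreal (4 * c) * Q)"
    using TS B by (intro add_mono mult_left_mono) auto
  finally have A: "A \<le> Q + ennreal (2 powr p) * (Q + ennreal (4 * c) * Q)" .
  have "eqW_sum p l f \<le> Q + (Q + ennreal (2 powr p) * (Q + ennreal (4 * c) * Q))
      + ennreal (4 * c) * Q"
    unfolding E using TS A B by (intro add_mono) auto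
  also have "\<dots> = ennreal (1 + (1 + 2 powr p * (1 + 4 * c)) + 4 * c) * Q"
  proof -
    have "ennreal (1 + (1 + 2 powr p * (1 + 4 * c)) + 4 * c)
        = 1 + (1 + ennreal (2 powr p) * (1 + ennreal (4 * c))) + ennreal (4 * c)"
      using c by (simp add: ennreal_plus ennreal_mult)
    then show ?thesis
      by (simp only: distrib_left distrib_right mult.assoc mult_1 mult_1_right)
  qed
  also have "\<dots> \<le> ennreal ((500 * M) powr p) * Q"
  proof (intro mult_right_mono ennreal_leI)
    \<comment> \<open>Every term is at most a multiple of \<open>2 powr p * c\<close>. Eleven copies
      would do; with 20 the base becomes 20 * 24 = 480, rounded up to 500.\<close>
    have "2 powr p * 1 \<le> 2 powr p * c"
      using c by (intro mult_left_mono) auto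
    moreover have "1 * c \<le> 2 powr p * c"
      using c ge_one_powr_ge_zero[of 2 p] p by (intro mult_right_mono) auto
    ultimately have "1 + (1 + 2 powr p * (1 + 4 * c)) + 4 * c \<le> 20 * (2 powr p * c)"
      using c unfolding distrib_left mult.left_commute[of _ 4] by linarith
    also have "\<dots> = 20 * (24 * M) powr p"
      using M1 powr_mult[of 2 "12 * M" p] by (simp add: c_def)
    also have "\<dots> \<le> (20 * (24 * M)) powr p"
      using M1 p by (intro const_mult_powr_le) auto
    also have "\<dots> \<le> (500 * M) powr p"
      using M1 p by (intro powr_mono2) auto
    finally show "1 + (1 + 2 powr p * (1 + 4 * c)) + 4 * c \<le> (500 * M) powr p" .
  qed auto
  finally show ?thesis
    by (simp add: Q_def)
qed

theorem proposition6:
  fixes K :: real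
  assumes "K > 0"
  shows "\<exists>C C' :: real. C > 0 \<and> C' > 0 \<and>
    (\<forall>(p::real) (l :: int \<Rightarrow> real) (f :: real \<Rightarrow> complex).
       1 \<le> p \<longrightarrow> strict_mono l \<longrightarrow> (\<forall>n. l (n + 1) - l n \<le> K) \<longrightarrow>
         ennreal C * norm_eqW p l f \<le> norm_simpW p l f \<and>
         norm_simpW p l f \<le> ennreal C' * norm_eqW p l f)"
proof -
  define M where "M = max 1 (2 * K\<^sup>2)"
  have M: "0 < M"
    by (simp add: M_def)
  \<comment> \<open>The lower constant is the reciprocal of the factor from
    \<open>eqW_sum_le\<close>; \<open>M\<close> depends on \<open>K\<close> alone.\<close>
  have "ennreal (1 / (500 * M)) * norm_eqW p l f \<le> norm_simpW p l f \<and>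
      norm_simpW p l f \<le> ennreal 3 * norm_eqW p l f"
    if p: "1 \<le> p" and l: "strict_mono l" and K: "\<forall>n. l (n + 1) - l n \<le> K"
    for p l and f :: "real \<Rightarrow> complex"
  proof
    have "norm_eqW p l f \<le> ennreal (500 * M) * norm_simpW p l f"
      unfolding norm_eqW_def norm_simpW_def
      using eqW_sum_le[OF l _ p M_def, of f] K p M
      by (intro ennreal_powr_root_le) auto
    then have "ennreal (1 / (500 * M)) * norm_eqW p l f
        \<le> ennreal (1 / (500 * M)) * (ennreal (500 * M) * norm_simpW p l f)"
      by (rule mult_left_mono) simp
    also have "\<dots> = norm_simpW p l f"
      using M by (simp flip: mult.assoc ennreal_mult)
    finally show "ennreal (1 / (500 * M)) * norm_eqW p l f \<le> norm_simpW p l f" .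
    show "norm_simpW p l f \<le> ennreal 3 * norm_eqW p l f"
      unfolding norm_eqW_def norm_simpW_def
      using simpW_sum_le[OF l p, of f] p by (intro ennreal_powr_root_le) auto
  qed
  with M show ?thesis
    by (intro exI[of _ "1 / (500 * M)"] exI[of _ "3::real"]) auto
qed

end
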